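(* Let $N=\{1,\dots,n\}$ be a finite player set and let $v\colon 2^N\to\mathbb R$ be a regular cooperative game on $N$. (a) Let $\alpha>0$ and put $\beta=\tfrac1\alpha$. Then the $\alpha$-Gately value $g^\alpha(v)\in\mathbb I(v)$ is the unique imputation satisfying $$\rho^\beta_i\big(g^\alpha(v)\big)\leqslant \min_{x\in\mathbb I(v)}\ \max_{j\in N}\ \rho^\beta_j(x)\qquad\text{for every player } i\in N .$$ (b) Let $0<\alpha<1$ and put $\beta=\tfrac{1-\alpha}{\alpha}>0$. Then the $\alpha$-Gately value $g^\alpha(v)\in\mathbb I(v)$ is the unique solution of the minimisation problem $$g^\alpha(v)=\arg\min_{x\in\mathbb I(v)}\ \sum_{j\in N}\rho^\beta_j(x).$$
   Context: A cooperative game on $N$ is a function $v\colon 2^N\to\mathbb R$ with $v(\varnothing)=0$. Write $v_i=v(\{i\})$ and $M_i(v)=v(N)-v(N\setminus\{i\})$ for $i\in N$. The game $v$ is regular if: (essential) $\sum_{j\in N}v_j\leqslant v(N)\leqslant\sum_{j\in N}M_j(v)$; and (standard) $v_i\leqslant M_i(v)$ for every $i\in N$, with $v_j<M_j(v)$ for at least one $j\in N$. The set of imputations is $\mathbb I(v)=\{x\in\mathbb R^N\mid \sum_{i\in N}x_i=v(N),\ x_i\geqslant v_i\text{ for all }i\in N\}$. For $\alpha>0$ the $\alpha$-Gately value of $v$ is the vector $g^\alpha(v)\in\mathbb R^N$ with $$g^\alpha_i(v)=v_i+\frac{(M_i(v)-v_i)^\alpha}{\sum_{j\in N}(M_j(v)-v_j)^\alpha}\Big(v(N)-\sum_{j\in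 N}v_j\Big),\qquad i\in N.$$ For $\beta>0$ the generalised $\beta$-propensity to disrupt of player $i\in N$ at $x\in\mathbb I(v)$ is $$\rho^\beta_i(x)=\frac{M_i(v)-v_i}{(x_i-v_i)^\beta},$$ taking values in $[0,+\infty]$ with the conventions: $\rho^\beta_i(x)=+\infty$ if $x_i=v_i$ and $M_i(v)>v_i$; $\rho^\beta_i(x)=0$ if $M_i(v)=v_i$ (including when $x_i=v_i$). Minima, maxima and sums are taken in $[0,+\infty]$. *)

theory Defs
  imports "HOL-Analysis.Analysis"
begin

text \<open>
  The player set is the finite type \<open>'n\<close>: coalitions are elements of \<open>'n set\<close>, the grand
  coalition is \<open>UNIV\<close>, and payoff vectors are elements of \<open>real ^ 'n\<close>.
\<close>

definition cooperative_game :: "('n::finite set \<Rightarrow> real) \<Rightarrow> bool" where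
  "cooperative_game v \<longleftrightarrow> v {} = 0"

definition marginal :: "('n::finite set \<Rightarrow> real) \<Rightarrow> 'n \<Rightarrow> real" where
  "marginal v i = v UNIV - v (UNIV - {i})"

definition essential_game :: "('n::finite set \<Rightarrow> real) \<Rightarrow> bool" where
  "essential_game v \<longleftrightarrow>
     (\<Sum>j\<in>UNIV. v {j}) \<le> v UNIV \<and> v UNIV \<le> (\<Sum>j\<in>UNIV. marginal v j)"

definition standard_game :: "('n::finite set \<Rightarrow> real) \<Rightarrow> bool" where
  "standard_game v \<longleftrightarrow> (\<forall>i. v {i} \<le> marginal v i) \<and> (\<exists>j. v {j} < marginal v j)"

definition regular_game :: "('n::finite set \<Rightarrow> real) \<Rightarrow> bool" where
  "regular_game v \<longleftrightarrow> essential_game v \<and> standard_game v"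

definition imputations :: "('n::finite set \<Rightarrow> real) \<Rightarrow> (real ^ 'n) set" where
  "imputations v = {x. (\<Sum>i\<in>UNIV. x $ i) = v UNIV \<and> (\<forall>i. x $ i \<ge> v {i})}"

definition gately_value :: "real \<Rightarrow> ('n::finite set \<Rightarrow> real) \<Rightarrow> real ^ 'n" where
  "gately_value \<alpha> v = (\<chi> i. v {i} +
     (marginal v i - v {i}) powr \<alpha> / (\<Sum>j\<in>UNIV. (marginal v j - v {j}) powr \<alpha>)
       * (v UNIV - (\<Sum>j\<in>UNIV. v {j})))"

text \<open>
  Only meaningful for standard games and imputations \<open>x\<close>, where
  \<open>v {i} \<le> marginal v i\<close> and \<open>v {i} \<le> x $ i\<close>.
\<close>

definition propensity ::
  "real \<Rightarrow> ('n::finite set \<Rightarrow> real) \<Rightarrow> real ^ 'n \<Rightarrow> 'n \<Rightarrow> ennreal" where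
  "propensity \<beta> v x i =
     (if marginal v i = v {i} then 0
      else if x $ i = v {i} then \<infinity>
      else ennreal ((marginal v i - v {i}) / (x $ i - v {i}) powr \<beta>))"

definition max_propensity :: "real \<Rightarrow> ('n::finite set \<Rightarrow> real) \<Rightarrow> real ^ 'n \<Rightarrow> ennreal" where
  "max_propensity \<beta> v x = Max (range (propensity \<beta> v x))"

definition total_propensity :: "real \<Rightarrow> ('n::finite set \<Rightarrow> real) \<Rightarrow> real ^ 'n \<Rightarrow> ennreal" where
  "total_propensity \<beta> v x = (\<Sum>j\<in>UNIV. propensity \<beta> v x j)"

end

theory Submission
  imports Defs
begin

text \<open>
  Write \<open>d\<^sub>i = M\<^sub>i - v\<^sub>i\<close>, \<open>y\<^sub>i = x\<^sub>i - v\<^sub>i\<close> and let \<open>V\<close> be the surplus to be divided, so that the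
  \<open>y\<^sub>i \<ge> 0\<close> sum to \<open>V\<close>; if \<open>V = 0\<close>, there is only one imputation. Let \<open>V > 0\<close> and
  \<open>S = (\<Sum>i. d\<^sub>i powr \<alpha>)\<close>. For (a), the Gately value gives all players with \<open>d\<^sub>i > 0\<close>
  the same propensity \<open>c = (S / V) powr (1 / \<alpha>)\<close>, and \<open>\<rho>\<^sub>i \<le> c\<close> says exactly that \<open>y\<^sub>i\<close> is at
  least the Gately share; as both sum to \<open>V\<close>, they agree. For (b), bound the strictly
  convex \<open>d\<^sub>i / y\<^sub>i powr \<beta>\<close> from below by its tangent at the Gately share. The slope is \<open>- \<beta> c\<close>
  whenever \<open>d\<^sub>i > 0\<close>, and for \<open>d\<^sub>i = 0\<close> the bound \<open>0 \<ge> - \<beta> c y\<^sub>i\<close> of the same slope is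
  trivial, so the linear terms cancel in the sum.
\<close>

section \<open>Gaps, surplus and shares\<close>

definition gap :: "('n::finite set \<Rightarrow> real) \<Rightarrow> 'n \<Rightarrow> real" where
  "gap v i = marginal v i - v {i}"

definition surplus :: "('n::finite set \<Rightarrow> real) \<Rightarrow> real" where
  "surplus v = v UNIV - (\<Sum>j\<in>UNIV. v {j})"

definition gap_sum :: "real \<Rightarrow> ('n::finite set \<Rightarrow> real) \<Rightarrow> real" where
  "gap_sum \<alpha> v = (\<Sum>j\<in>UNIV. gap v j powr \<alpha>)"

definition gately_share :: "real \<Rightarrow> ('n::finite set \<Rightarrow> real) \<Rightarrow> 'n \<Rightarrow> real" where
  "gately_share \<alpha> v i = gap v i powr \<alpha> * (surplus v / gap_sum \<alpha> v)"

text \<open>Scaling by \<open>t\<close> reduces this to 1 - \<beta> (u - 1) < 1 / u powr \<beta> for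
  u = y / t. It follows from ln u < u - 1, the source of the strictness, and 1 + z \<le> exp z at z
  = - \<beta> ln u.\<close>

lemma powr_tangent_less:
  fixes y t \<beta> :: real
  assumes "0 < y" "0 < t" "0 < \<beta>" "y \<noteq> t"
  shows "1 / t powr \<beta> - \<beta> / t powr (\<beta> + 1) * (y - t) < 1 / y powr \<beta>"
proof -
  define u where "u = y / t"
  have u: "0 < u" "u \<noteq> 1" and y: "y = u * t"
    using assms by (auto simp: u_def)
  have "ln u < u - 1"
    using u ln_le_minus_one[of u] ln_eq_minus_one[of u] by force
  then have "1 - \<beta> * (u - 1) < 1 + (- \<beta> * ln u)"
    using assms(3) by simp
  also have "\<dots> \<le> exp (- \<beta> * ln u)"
    by (rule exp_ge_add_one_self)
  also have "\<dots> = 1 / u powr \<beta>"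
    using u by (simp add: powr_def exp_minus field_simps)
  finally have "(1 - \<beta> * (u - 1)) / t powr \<beta> < 1 / u powr \<beta> / t powr \<beta>"
    using assms(2) by (intro divide_strict_right_mono) auto
  moreover have "1 / t powr \<beta> - \<beta> / t powr (\<beta> + 1) * (y - t) = (1 - \<beta> * (u - 1)) / t powr \<beta>"
    using assms(2) by (simp add: y powr_add field_simps)
  moreover have "1 / y powr \<beta> = 1 / u powr \<beta> / t powr \<beta>"
    using u assms(2) by (simp add: y powr_mult)
  ultimately show ?thesis
    by simp
qed

lemma gately_value_nth: "gately_value \<alpha> v $ i = v {i} + gately_share \<alpha> v i"
  by (simp add: gately_value_def gately_share_def gap_sum_def gap_def surplus_def)

text \<open>For gap 0 the real quotient is 0 even at x $ i = v {i}, where it reads 0 / 0, so it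
  agrees with the convention.\<close>

lemma propensity_eq_ennreal:
  assumes "gap v i = 0 \<or> x $ i \<noteq> v {i}"
  shows "propensity \<beta> v x i = ennreal (gap v i / (x $ i - v {i}) powr \<beta>)"
  using assms by (auto simp: propensity_def gap_def)

lemma propensity_eq_top:
  assumes "gap v i \<noteq> 0" "x $ i = v {i}"
  shows "propensity \<beta> v x i = \<infinity>"
  using assms by (auto simp: propensity_def gap_def)

lemma imputations_excess:
  assumes "x \<in> imputations v"
  shows "(\<Sum>i\<in>UNIV. x $ i - v {i}) = surplus v" and "0 \<le> x $ i - v {i}"
  using assms by (auto simp: imputations_def surplus_def sum_subtractf)

lemma max_propensity_le_iff:
  "max_propensity \<beta> v x \<le> c \<longleftrightarrow> (\<forall>i. propensity \<beta> v x i \<le> c)"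
  by (simp add: max_propensity_def)

section \<open>Regular games: the Gately value as an imputation\<close>

context
  fixes v :: "'n::finite set \<Rightarrow> real"
  assumes regular: "regular_game v"
begin

lemma gap_nonneg: "0 \<le> gap v i"
  using regular by (simp add: regular_game_def standard_game_def gap_def)

lemma surplus_nonneg: "0 \<le> surplus v"
  using regular by (simp add: regular_game_def essential_game_def surplus_def)

lemma gap_sum_pos: "0 < gap_sum \<alpha> v"
proof -
  obtain j where "v {j} < marginal v j"
    using regular by (auto simp: regular_game_def standard_game_def)
  then have "0 < gap v j powr \<alpha>"
    by (simp add: gap_def)
  then show ?thesis
    unfolding gap_sum_def by (intro sum_pos2[of _ j]) auto
qed

lemma gately_share_nonneg: "0 \<le> gately_share \<alpha> v i"
  using surplus_nonneg gap_sum_pos[of \<alpha>] by (simp add: gately_share_def)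

lemma sum_gately_share: "(\<Sum>i\<in>UNIV. gately_share \<alpha> v i) = surplus v"
  using gap_sum_pos[of \<alpha>]
  unfolding gately_share_def sum_distrib_right[symmetric] gap_sum_def[symmetric] by simp

lemma gately_value_imputation: "gately_value \<alpha> v \<in> imputations v"
  using sum_gately_share[of \<alpha>] gately_share_nonneg[of \<alpha>]
  by (simp add: imputations_def gately_value_nth sum.distrib surplus_def)

text \<open>The nonnegative differences sum to zero, since excesses and shares have the same total.
  Uniqueness in the minimax part rests on this.\<close>

lemma imputation_eq_gately_valueI:
  assumes "x \<in> imputations v" and "\<And>i. gately_share \<alpha> v i \<le> x $ i - v {i}"
  shows "x = gately_value \<alpha> v"
proof -
  have "(\<Sum>i\<in>UNIV. x $ i - v {i} - gately_share \<alpha> v i) = 0"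
    using imputations_excess(1)[OF assms(1)] sum_gately_share[of \<alpha>]
    by (simp add: sum_subtractf)
  then have "x $ i - v {i} - gately_share \<alpha> v i = 0" for i
    using assms(2) by (subst (asm) sum_nonneg_eq_0_iff) auto
  then show ?thesis
    by (simp add: vec_eq_iff gately_value_nth algebra_simps)
qed

text \<open>All Gately shares vanish, so every imputation dominates them.\<close>

lemma imputations_singleton:
  assumes "surplus v = 0"
  shows "imputations v = {gately_value \<alpha> v}"
proof -
  have "x = gately_value \<alpha> v" if "x \<in> imputations v" for x
    using that imputations_excess(2)[OF that] assms
    by (intro imputation_eq_gately_valueI) (simp_all add: gately_share_def)
  then show ?thesis
    using gately_value_imputation by blast
qed

section \<open>Positive surplus: the minimax level, then the strict minimum of total
  propensity\<close>

context
  fixes \<alpha> :: real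
  assumes alpha: "0 < \<alpha>" and surplus_pos: "0 < surplus v"
begin

lemma gately_share_pos: "gap v i \<noteq> 0 \<Longrightarrow> 0 < gately_share \<alpha> v i"
  using surplus_pos gap_sum_pos[of \<alpha>] gap_nonneg[of i] by (simp add: gately_share_def)

text \<open>The power 1 / \<alpha> undoes the \<alpha> on the gap, so the ratio of gap to this power
  is the same for all players with nonzero gap. Both the common propensity and the common tangent
  slope come from here.\<close>

lemma gately_share_powr:
  "gately_share \<alpha> v i powr (1 / \<alpha>) = gap v i * (surplus v / gap_sum \<alpha> v) powr (1 / \<alpha>)"
  unfolding gately_share_def using alpha surplus_pos gap_sum_pos[of \<alpha>] gap_nonneg[of i]
  by (subst powr_mult) (simp_all add: powr_powr)

text \<open>The constant \<open>c\<close> of the overview, written as the reciprocal of the factor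
  in \<open>gately_share_powr\<close>.\<close>

definition level :: ennreal where
  "level = ennreal (1 / (surplus v / gap_sum \<alpha> v) powr (1 / \<alpha>))"

lemma propensity_gately_value:
  "propensity (1 / \<alpha>) v (gately_value \<alpha> v) i = (if gap v i = 0 then 0 else level)"
  using gately_share_pos[of i]
  by (auto simp: propensity_eq_ennreal gately_value_nth gately_share_powr level_def)

lemma gately_valueI_propensity:
  assumes x: "x \<in> imputations v" and le: "\<And>i. propensity (1 / \<alpha>) v x i \<le> level"
  shows "x = gately_value \<alpha> v"
proof (rule imputation_eq_gately_valueI[OF x])
  fix i
  let ?y = "x $ i - v {i}" and ?r = "(surplus v / gap_sum \<alpha> v) powr (1 / \<alpha>)"
  have y: "0 \<le> ?y"
    by (rule imputations_excess(2)[OF x])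
  have r: "0 < ?r"
    using surplus_pos gap_sum_pos[of \<alpha>] by simp
  show "gately_share \<alpha> v i \<le> ?y"
  proof (cases "gap v i = 0")
    case True
    then show ?thesis
      using y by (simp add: gately_share_def)
  next
    case False
    \<comment> \<open>Otherwise the propensity would be infinite, while \<open>level\<close> is
      finite.\<close>
    then have ne: "x $ i \<noteq> v {i}"
      using le[of i] propensity_eq_top[of v i x "1 / \<alpha>"] by (auto simp: level_def top_unique)
    then have "gap v i / ?y powr (1 / \<alpha>) \<le> 1 / ?r"
      using le[of i] r by (simp add: propensity_eq_ennreal level_def)
    then have "gately_share \<alpha> v i powr (1 / \<alpha>) \<le> ?y powr (1 / \<alpha>)"
      using y ne r by (simp add: gately_share_powr field_simps)
    then show ?thesis
      using y gately_share_nonneg[of \<alpha> i] alpha powr_less_mono2[of "1 / \<alpha>" ?y "gately_share \<alpha> v i"]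
      by fastforce
  qed
qed

lemma max_propensity_gately_value: "max_propensity (1 / \<alpha>) v (gately_value \<alpha> v) = level"
proof (rule antisym)
  show "max_propensity (1 / \<alpha>) v (gately_value \<alpha> v) \<le> level"
    by (simp add: max_propensity_le_iff propensity_gately_value)
  \<comment> \<open>A player with positive gap is needed to attain \<open>level\<close>, as the
    others have propensity 0.\<close>
  obtain j where "v {j} < marginal v j"
    using regular by (auto simp: regular_game_def standard_game_def)
  then have "propensity (1 / \<alpha>) v (gately_value \<alpha> v) j = level"
    by (simp add: propensity_gately_value gap_def)
  then show "level \<le> max_propensity (1 / \<alpha>) v (gately_value \<alpha> v)"
    unfolding max_propensity_def by (metis Max_ge finite finite_imageI rangeI)
qed

text \<open>A smaller maximum would force \<open>x\<close> to be the Gately value, whose maximum is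
  \<open>level\<close> itself.\<close>

lemma level_le_max_propensity:
  assumes "x \<in> imputations v"
  shows "level \<le> max_propensity (1 / \<alpha>) v x"
proof (rule ccontr)
  assume *: "\<not> level \<le> max_propensity (1 / \<alpha>) v x"
  then have "max_propensity (1 / \<alpha>) v x \<le> level"
    by simp
  then have "x = gately_value \<alpha> v"
    using gately_valueI_propensity[OF assms] by (simp add: max_propensity_le_iff)
  with * show False
    by (simp add: max_propensity_gately_value)
qed

text \<open>The slope does not depend on \<open>i\<close>. The second condition on \<open>y\<close>
  excludes infinite propensities, where the real quotient would wrongly be 0.\<close>

lemma gap_divide_powr_tangent:
  assumes \<beta>: "\<beta> = (1 - \<alpha>) / \<alpha>" "\<alpha> < 1" and y: "0 \<le> y" "gap v i \<noteq> 0 \<Longrightarrow> y \<noteq> 0"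
  defines "t \<equiv> gately_share \<alpha> v i"
    and "c \<equiv> 1 / (surplus v / gap_sum \<alpha> v) powr (1 / \<alpha>)"
  shows "gap v i / t powr \<beta> - \<beta> * c * (y - t) \<le> gap v i / y powr \<beta>"
    and "y \<noteq> t \<Longrightarrow> gap v i / t powr \<beta> - \<beta> * c * (y - t) < gap v i / y powr \<beta>"
proof -
  have pos: "0 < \<beta>" "0 < c"
    using alpha \<beta> surplus_pos gap_sum_pos[of \<alpha>] by (auto simp: c_def)
  show less: "gap v i / t powr \<beta> - \<beta> * c * (y - t) < gap v i / y powr \<beta>" if "y \<noteq> t"
  proof (cases "gap v i = 0")
    case True
    \<comment> \<open>Here t = 0 < y: both quotients are 0 and the linear term makes the left side
      negative.\<close>
    then show ?thesis
      using that y pos by (simp add: t_def gately_share_def)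
  next
    case False
    then have g: "0 < gap v i" and t: "0 < t" and y0: "0 < y"
      using gap_nonneg[of i] gately_share_pos[of i] y by (auto simp: t_def)
    \<comment> \<open>This identity dictates the choice of \<beta>: the exponent in the derivative
      becomes the one that equalises the players.\<close>
    have "\<beta> + 1 = 1 / \<alpha>"
      using alpha \<beta> by (simp add: field_simps)
    then have c: "gap v i / t powr (\<beta> + 1) = c"
      using g by (simp add: t_def c_def gately_share_powr)
    have "gap v i * (1 / t powr \<beta> - \<beta> / t powr (\<beta> + 1) * (y - t)) < gap v i * (1 / y powr \<beta>)"
      using powr_tangent_less[OF y0 t pos(1) that] g by (rule mult_strict_left_mono)
    moreover have "gap v i * (1 / t powr \<beta> - \<beta> / t powr (\<beta> + 1) * (y - t))
        = gap v i / t powr \<beta> - \<beta> * (gap v i / t powr (\<beta> + 1)) * (y - t)"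
      by (simp add: algebra_simps)
    ultimately show ?thesis
      unfolding c by simp
  qed
  then show "gap v i / t powr \<beta> - \<beta> * c * (y - t) \<le> gap v i / y powr \<beta>"
    by (cases "y = t") auto
qed

lemma total_propensity_gately_value_less:
  assumes \<beta>: "\<beta> = (1 - \<alpha>) / \<alpha>" "\<alpha> < 1"
    and x: "x \<in> imputations v" "x \<noteq> gately_value \<alpha> v"
  shows "total_propensity \<beta> v (gately_value \<alpha> v) < total_propensity \<beta> v x"
proof -
  let ?t = "gately_share \<alpha> v" and ?y = "\<lambda>i. x $ i - v {i}"
  have prop_g: "propensity \<beta> v (gately_value \<alpha> v) i = ennreal (gap v i / ?t i powr \<beta>)" for i
    using gately_share_pos[of i] by (subst propensity_eq_ennreal) (auto simp: gately_value_nth)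
  have total_g: "total_propensity \<beta> v (gately_value \<alpha> v) = ennreal (\<Sum>i\<in>UNIV. gap v i / ?t i powr \<beta>)"
    unfolding total_propensity_def prop_g using gap_nonneg by (intro sum_ennreal) simp
  show ?thesis
  \<comment> \<open>An infinite propensity makes the total at \<open>x\<close> infinite, against a
    finite total at the Gately value; otherwise both totals are real sums.\<close>
  proof (cases "\<exists>i. gap v i \<noteq> 0 \<and> x $ i = v {i}")
    case True
    then have "\<exists>i. propensity \<beta> v x i = top"
      using propensity_eq_top by fastforce
    then have "total_propensity \<beta> v x = top"
      unfolding total_propensity_def by (subst ennreal_sum_eq_top) auto
    then show ?thesis
      by (simp add: total_g)
  next
    case False
    then have ne: "gap v i \<noteq> 0 \<Longrightarrow> ?y i \<noteq> 0" for i
      by auto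
    have prop_x: "propensity \<beta> v x i = ennreal (gap v i / ?y i powr \<beta>)" for i
      using False by (intro propensity_eq_ennreal) blast
    have total_x: "total_propensity \<beta> v x = ennreal (\<Sum>i\<in>UNIV. gap v i / ?y i powr \<beta>)"
      unfolding total_propensity_def prop_x using gap_nonneg by (intro sum_ennreal) simp
    \<comment> \<open>The negated common slope; being constant, it factors out of the sum of the
      linear terms, which is therefore 0.\<close>
    define k where "k = \<beta> * (1 / (surplus v / gap_sum \<alpha> v) powr (1 / \<alpha>))"
    obtain j where j: "?y j \<noteq> ?t j"
      using x(2) by (auto simp: vec_eq_iff gately_value_nth algebra_simps)
    have "(\<Sum>i\<in>UNIV. ?y i - ?t i) = 0"
      using imputations_excess(1)[OF x(1)] sum_gately_share[of \<alpha>] by (simp add: sum_subtractf)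
    then have "(\<Sum>i\<in>UNIV. k * (?y i - ?t i)) = 0"
      by (simp flip: sum_distrib_left)
    then have "(\<Sum>i\<in>UNIV. gap v i / ?t i powr \<beta>) = (\<Sum>i\<in>UNIV. gap v i / ?t i powr \<beta> - k * (?y i - ?t i))"
      by (simp only: sum_subtractf)
    also have "\<dots> < (\<Sum>i\<in>UNIV. gap v i / ?y i powr \<beta>)"
    proof (rule sum_strict_mono_ex1)
      have tangent: "gap v i / ?t i powr \<beta> - k * (?y i - ?t i) \<le> gap v i / ?y i powr \<beta>"
        "?y i \<noteq> ?t i \<Longrightarrow> gap v i / ?t i powr \<beta> - k * (?y i - ?t i) < gap v i / ?y i powr \<beta>" for i
        unfolding k_def
        by (intro gap_divide_powr_tangent \<beta> imputations_excess(2)[OF x(1)] ne; assumption)+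
      show "\<forall>i\<in>UNIV. gap v i / ?t i powr \<beta> - k * (?y i - ?t i) \<le> gap v i / ?y i powr \<beta>"
        by (intro ballI tangent(1))
      show "\<exists>i\<in>UNIV. gap v i / ?t i powr \<beta> - k * (?y i - ?t i) < gap v i / ?y i powr \<beta>"
        using tangent(2)[OF j] by blast
    qed simp
    finally show ?thesis
      unfolding total_g total_x using gap_nonneg
      by (simp add: ennreal_less_iff sum_nonneg)
  qed
qed

end

section \<open>Both optimality statements for arbitrary surplus\<close>

lemma gately_value_minimax:
  assumes "0 < \<alpha>"
  shows "is_arg_min (max_propensity (1 / \<alpha>) v) (\<lambda>y. y \<in> imputations v) (gately_value \<alpha> v)"
    and "{x \<in> imputations v.
        \<forall>i. propensity (1 / \<alpha>) v x i \<le> (INF y\<in>imputations v. max_propensity (1 / \<alpha>) v y)}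
      = {gately_value \<alpha> v}"
proof -
  let ?g = "gately_value \<alpha> v" and ?m = "max_propensity (1 / \<alpha>) v"
  \<comment> \<open>The Gately value is a minimiser, and the only one.\<close>
  have *: "?m ?g \<le> ?m x \<and> (?m x \<le> ?m ?g \<longrightarrow> x = ?g)" if "x \<in> imputations v" for x
  proof (cases "surplus v = 0")
    case True
    then show ?thesis
      using that imputations_singleton[of \<alpha>] by simp
  next
    case False
    then have "0 < surplus v"
      using surplus_nonneg by simp
    then show ?thesis
      using assms that level_le_max_propensity[of \<alpha> x] gately_valueI_propensity[of \<alpha> x]
      by (simp add: max_propensity_gately_value max_propensity_le_iff)
  qed
  show "is_arg_min ?m (\<lambda>y. y \<in> imputations v) ?g"
    using * gately_value_imputation by (simp add: is_arg_min_linorder)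
  have "(INF y\<in>imputations v. ?m y) = ?m ?g"
    using * gately_value_imputation by (intro antisym INF_lower INF_greatest) auto
  \<comment> \<open>Bounding every player by the minimum amounts to bounding the maximum, so the set
    consists of the minimisers.\<close>
  then show "{x \<in> imputations v. \<forall>i. propensity (1 / \<alpha>) v x i \<le> (INF y\<in>imputations v. ?m y)} = {?g}"
    using * gately_value_imputation by (auto simp flip: max_propensity_le_iff)
qed

lemma gately_value_total_propensity:
  assumes "0 < \<alpha>" "\<alpha> < 1" "\<beta> = (1 - \<alpha>) / \<alpha>"
  shows "{x. is_arg_min (total_propensity \<beta> v) (\<lambda>y. y \<in> imputations v) x} = {gately_value \<alpha> v}"
proof -
  let ?g = "gately_value \<alpha> v"
  have "total_propensity \<beta> v ?g < total_propensity \<beta> v x" if "x \<in> imputations v" "x \<noteq> ?g" for x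
  proof (cases "surplus v = 0")
    case True
    then show ?thesis
      using that imputations_singleton[of \<alpha>] by simp
  next
    case False
    then have "0 < surplus v"
      using surplus_nonneg by simp
    with assms that show ?thesis
      by (intro total_propensity_gately_value_less)
  qed
  then have "is_arg_min (total_propensity \<beta> v) (\<lambda>y. y \<in> imputations v) x \<longleftrightarrow> x = ?g" for x
    unfolding is_arg_min_def using gately_value_imputation[of \<alpha>] order_less_asym by metis
  then show ?thesis
    by simp
qed

end

theorem theorem3p6:
  fixes v :: "'n::finite set \<Rightarrow> real"
  assumes "cooperative_game v" and "regular_game v"
  shows
    "(\<forall>\<alpha> \<beta>. 0 < \<alpha> \<and> \<beta> = 1 / \<alpha> \<longrightarrow>
        gately_value \<alpha> v \<in> imputations v \<and>
        (\<exists>z. is_arg_min (max_propensity \<beta> v) (\<lambda>y. y \<in> imputations v) z) \<and>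
        {x \<in> imputations v.
           \<forall>i. propensity \<beta> v x i \<le> (INF y\<in>imputations v. max_propensity \<beta> v y)}
          = {gately_value \<alpha> v})
     \<and>
     (\<forall>\<alpha> \<beta>. 0 < \<alpha> \<and> \<alpha> < 1 \<and> \<beta> = (1 - \<alpha>) / \<alpha> \<longrightarrow>
        gately_value \<alpha> v \<in> imputations v \<and>
        {x. is_arg_min (total_propensity \<beta> v) (\<lambda>y. y \<in> imputations v) x}
          = {gately_value \<alpha> v})"
proof (intro conjI allI impI; elim conjE)
  fix \<alpha> \<beta> :: real
  assume "0 < \<alpha>" and \<beta>: "\<beta> = 1 / \<alpha>"
  note minimax = gately_value_minimax[OF assms(2) this(1), folded \<beta>]
  show "gately_value \<alpha> v \<in> imputations v"
    by (rule gately_value_imputation[OF assms(2)])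
  show "\<exists>z. is_arg_min (max_propensity \<beta> v) (\<lambda>y. y \<in> imputations v) z"
    using minimax(1) by (rule exI)
  show "{x \<in> imputations v.
      \<forall>i. propensity \<beta> v x i \<le> (INF y\<in>imputations v. max_propensity \<beta> v y)}
    = {gately_value \<alpha> v}"
    by (rule minimax(2))
next
  fix \<alpha> \<beta> :: real
  assume "0 < \<alpha>" "\<alpha> < 1" "\<beta> = (1 - \<alpha>) / \<alpha>"
  then show "{x. is_arg_min (total_propensity \<beta> v) (\<lambda>y. y \<in> imputations v) x} = {gately_value \<alpha> v}"
    by (rule gately_value_total_propensity[OF assms(2)])
qed (rule gately_value_imputation[OF assms(2)])

end
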